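(* Let $\{x_0^k\}_{k\ge1}$ be generated by the 2-level MGProx algorithm (see context) from an initial guess $x_0^1\in\mathbb{R}^{n_0}$. Let $x^*=\mathrm{argmin}\,F_0$, $F_0^*=F_0(x^* )$, and let $$\delta=\sup\{\|x-y\|_2 : F_0(x)\le F_0(x_0^1),\ F_0(y)\le F_0(x_0^1)\}$$ be the diameter of the sublevel set of $F_0$ at level $F_0(x_0^1)$. Then for all $k\ge1$ $$F_0(x_0^{k+1})-F_0^*\;\le\;\frac{\max\{8\delta^2L_0,\;F_0(x_0^1)-F_0^*\}}{k}.$$
   Context: Problem: minimize $F_0(x)=f_0(x)+g_0(x)$ over $x\in\mathbb{R}^{n_0}$. Here $f_0:\mathbb{R}^{n_0}\to\mathbb{R}$ is $L_0$-smooth (differentiable with $L_0$-Lipschitz gradient) and $\mu_0$-strongly convex, $\mu_0>0$ (i.e. $f_0-\frac{\mu_0}{2}\|\cdot\|_2^2$ is convex); $g_0:\mathbb{R}^{n_0}\to\mathbb{R}$ is proper, convex, possibly nonsmooth and separable, $g_0(x)=\sum_i g_{0,i}(x_i)$, with a single point of nondifferentiability (each $g_{0,i}$ is nondifferentiable at at most one point). $\partial$ denotes the convex subdifferential. Coarse functions: let $n_1\le n_0$ and let $Q\in\mathbb{R}^{n_0\times n_1}$ have rank $n_1$. Put $f_1=f_0\circ Q$, $g_1=g_0\circ Q$, $F_1=f_1+g_1=F_0\circ Q:\mathbb{R}^{n_1}\to\mathbb{R}$. Adaptive restriction and prolongation: given a full restriction matrix $\overline{R}\in\mathbb{R}^{n_1\times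 n_0}$, for $y\in\mathbb{R}^{n_0}$ the adaptive restriction matrix $R(y)$ is obtained from $\overline{R}$ by setting to zero every column $i$ for which $\partial g_{0,i}(y_i)$ is not a singleton. Thus $R(y)\,\partial F_0(y)$ is a singleton. The associated prolongation is $P=c\,R(y)^\top$ with a fixed constant $c>0$. Proximal operator: $\mathrm{prox}_{\beta g}(x)=\mathrm{argmin}_u\{\beta g(u)+\frac12\|u-x\|_2^2\}$. 2-level MGProx: for $k=1,2,\dots$, given $x_0^k$, (i) $y_0^{k+1}=\mathrm{prox}_{\frac1{L_0}g_0}\big(x_0^k-\frac1{L_0}\nabla f_0(x_0^k)\big)$; (ii) $y_1^{k+1}=R(y_0^{k+1})\,y_0^{k+1}$; (iii) choose any $\tau_{0\to1}^{k+1}\in \partial F_1(y_1^{k+1})-R(y_0^{k+1})\,\partial F_0(y_0^{k+1})$; (iv) $x_1^{k+1}=\mathrm{argmin}_{\xi\in\mathbb{R}^{n_1}}\{F_1(\xi)-\langle\tau_{0\to1}^{k+1},\xi\rangle\}$; (v) $z_0^{k+1}=y_0^{k+1}+\alpha P(x_1^{k+1}-y_1^{k+1})$ with $P=c\,R(y_0^{k+1})^\top$; (vi) $x_0^{k+1}=\mathrm{prox}_{\frac1{L_0}g_0}\big(z_0^{k+1}-\frac1{L_0}\nabla f_0(z_0^{k+1})\big)$. The stepsize $\alpha$ in (v) is chosen at each iteration by backtracking: starting from some $\alpha>0$, $\alpha$ is halved until $F_0(y_0^{k+1}+\alpha P(x_1^{k+1}-y_1^{k+1}))\le F_0(y_0^{k+1})$;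 if $\alpha$ falls below a fixed tolerance $\epsilon>0$ first, one sets $z_0^{k+1}=y_0^{k+1}$. In particular $F_0(z_0^{k+1})\le F_0(y_0^{k+1})$. *)

theory Defs
  imports "HOL-Analysis.Analysis"
begin

definition gradient :: "('a::real_inner \<Rightarrow> real) \<Rightarrow> 'a \<Rightarrow> 'a" where
  "gradient f x = (THE D. GDERIV f x :> D)"

definition smooth_fun :: "real \<Rightarrow> ('a::real_inner \<Rightarrow> real) \<Rightarrow> bool" where
  "smooth_fun L f \<longleftrightarrow> (\<forall>x. f differentiable (at x)) \<and> lipschitz_on L UNIV (gradient f)"

definition strongly_convex :: "real \<Rightarrow> ('a::real_inner \<Rightarrow> real) \<Rightarrow> bool" where
  "strongly_convex \<mu> f \<longleftrightarrow> 0 < \<mu> \<and> convex_on UNIV (\<lambda>x. f x - \<mu> / 2 * (norm x)\<^sup>2)"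

definition subdifferential :: "('a::real_inner \<Rightarrow> real) \<Rightarrow> 'a \<Rightarrow> 'a set" where
  "subdifferential f x = {v. \<forall>y. f x + inner v (y - x) \<le> f y}"

text \<open>The minimiser exists and is unique when \<open>g\<close> is convex, \<open>\<beta> \<ge> 0\<close> and the space is
  finite-dimensional; otherwise the value may be arbitrary.\<close>

definition prox :: "real \<Rightarrow> ('a::real_inner \<Rightarrow> real) \<Rightarrow> 'a \<Rightarrow> 'a" where
  "prox \<beta> g x = (ARG_MIN (\<lambda>u. \<beta> * g u + 1 / 2 * (norm (u - x))\<^sup>2) u. True)"

text \<open>Here \<open>g i\<close> is the \<open>i\<close>-th component of the separable function \<open>y \<mapsto> \<Sum>i. g i (y $ i)\<close>.\<close>

definition adaptive_restriction ::
    "('n \<Rightarrow> real \<Rightarrow> real) \<Rightarrow> real^'n^'m \<Rightarrow> real^'n \<Rightarrow> real^'n^'m" where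
  "adaptive_restriction g R y =
     (\<chi> j i. if is_singleton (subdifferential (g i) (y $ i)) then R $ j $ i else 0)"

definition prolongation ::
    "real \<Rightarrow> ('n \<Rightarrow> real \<Rightarrow> real) \<Rightarrow> real^'n^'m \<Rightarrow> real^'n \<Rightarrow> real^'m^'n" where
  "prolongation c g R y = c *\<^sub>R transpose (adaptive_restriction g R y)"

text \<open>\<open>backtracking F y d \<epsilon> \<alpha> z\<close>: the backtracking loop along the direction \<open>d\<close>, started
  with step size \<open>\<alpha>\<close>, returns the point \<open>z\<close>. If \<open>\<alpha>\<close> is already below the tolerance and is at the
  same time acceptable, both outcomes are allowed, so that the relation does not depend on the
  order in which an implementation performs the two tests.\<close>

inductive backtracking ::
    "('a::real_vector \<Rightarrow> real) \<Rightarrow> 'a \<Rightarrow> 'a \<Rightarrow> real \<Rightarrow> real \<Rightarrow> 'a \<Rightarrow> bool"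
  for F y d \<epsilon> where
  accept: "F (y + \<alpha> *\<^sub>R d) \<le> F y \<Longrightarrow> backtracking F y d \<epsilon> \<alpha> (y + \<alpha> *\<^sub>R d)"
| give_up: "\<alpha> < \<epsilon> \<Longrightarrow> backtracking F y d \<epsilon> \<alpha> y"
| halve: "\<lbrakk>\<not> F (y + \<alpha> *\<^sub>R d) \<le> F y; \<epsilon> \<le> \<alpha>; backtracking F y d \<epsilon> (\<alpha> / 2) z\<rbrakk>
    \<Longrightarrow> backtracking F y d \<epsilon> \<alpha> z"

end

theory Submission
  imports Defs
begin

text \<open>Each iteration consists of two proximal gradient steps with a non-increasing coarse correction
  in between. A proximal gradient step from \<open>x\<close> produces a point \<open>p\<close> with
  \<open>F p \<le> F u + L/2 |u - x|\<^sup>2\<close> for every \<open>u\<close>. Moving from \<open>x\<close> towards the minimiser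
  by a fraction \<open>t\<close> gives, for the errors \<open>e\<close>, the recursion
  \<open>e' \<le> (1 - t) e + t\<^sup>2 L \<delta>\<^sup>2 / 2\<close>; the choice \<open>t = 2 / (k + 1)\<close> makes \<open>C / k\<close>
  an invariant bound.\<close>

section \<open>Gradients and the quadratic upper bound\<close>

text \<open>\<open>gradient\<close> is a definite description, so it is usable only after existence
  and uniqueness are shown. Existence is the Riesz representation of the derivative, written out in
  an orthonormal basis.\<close>

lemma gderiv_gradient:
  fixes f :: "'a::euclidean_space \<Rightarrow> real"
  assumes "f differentiable (at x)"
  shows "GDERIV f x :> gradient f x"
proof -
  obtain f' where f': "(f has_derivative f') (at x)"
    using assms by (auto simp: differentiable_def)
  define D where "D = (\<Sum>b\<in>Basis. f' b *\<^sub>R b)"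
  interpret bounded_linear f' using f' by (rule has_derivative_bounded_linear)
  have "f' h = inner h D" for h
  proof -
    have "f' h = f' (\<Sum>b\<in>Basis. inner h b *\<^sub>R b)" by (simp add: euclidean_representation)
    also have "\<dots> = inner h D"
      by (simp add: sum scaleR D_def inner_sum_right mult.commute)
    finally show ?thesis .
  qed
  then have "f' = (\<lambda>h. inner h D)" by (rule ext)
  then have D: "GDERIV f x :> D"
    using f' by (simp add: gderiv_def)
  have "E = D" if E: "GDERIV f x :> E" for E
  proof -
    have "(\<lambda>h. inner h E) = (\<lambda>h. inner h D)"
      using D E unfolding gderiv_def by (rule has_derivative_unique[rotated])
    then have "inner h E = inner h D" for h by meson
    then show ?thesis by (metis vector_eq_ldot)
  qed
  with D show ?thesis unfolding gradient_def by (rule theI)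
qed

lemma gderiv_along_line:
  assumes "GDERIV f (x + t *\<^sub>R d) :> D"
  shows "((\<lambda>s. f (x + s *\<^sub>R d)) has_real_derivative inner d D) (at t)"
proof -
  have "((\<lambda>s. x + s *\<^sub>R d) has_derivative (\<lambda>s. s *\<^sub>R d)) (at t)"
    by (auto intro!: derivative_eq_intros)
  then have "((\<lambda>s. f (x + s *\<^sub>R d)) has_derivative (\<lambda>s. inner (s *\<^sub>R d) D)) (at t)"
    using assms unfolding gderiv_def by (rule has_derivative_compose)
  then show ?thesis
    by (rule has_derivative_imp_has_field_derivative) (simp add: mult.commute)
qed

text \<open>On the segment from \<open>x\<close> to \<open>y\<close>, let \<psi> be \<open>f\<close>
  minus the linear and quadratic terms of the bound. Cauchy-Schwarz and the Lipschitz gradient make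
  its derivative nonpositive for \<open>t \<ge> 0\<close>; comparing \<open>t = 1\<close> with
  \<open>t = 0\<close> gives the claim without integration.\<close>

lemma descent_lemma:
  fixes f :: "'a::euclidean_space \<Rightarrow> real"
  assumes "smooth_fun L f"
  shows "f y \<le> f x + inner (gradient f x) (y - x) + L / 2 * (norm (y - x))\<^sup>2"
proof -
  define d where "d = y - x"
  define \<psi> where
    "\<psi> t = f (x + t *\<^sub>R d) - (t * inner (gradient f x) d + L / 2 * t\<^sup>2 * (norm d)\<^sup>2)" for t
  have "\<exists>D. (\<psi> has_real_derivative D) (at t) \<and> D \<le> 0" if "0 \<le> t" for t
  proof -
    let ?G = "gradient f (x + t *\<^sub>R d)"
    have "GDERIV f (x + t *\<^sub>R d) :> ?G"
      using assms by (auto simp: smooth_fun_def intro: gderiv_gradient)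
    note [derivative_intros] = gderiv_along_line[OF this]
    have "(\<psi> has_real_derivative
        inner d ?G - (inner (gradient f x) d + L * t * (norm d)\<^sup>2)) (at t)"
      unfolding \<psi>_def by (auto intro!: derivative_eq_intros)
    moreover have "inner d ?G - inner (gradient f x) d \<le> L * t * (norm d)\<^sup>2"
    proof -
      have "inner d ?G - inner (gradient f x) d = inner (?G - gradient f x) d"
        by (simp add: inner_diff_right inner_commute)
      also have "\<dots> \<le> norm (?G - gradient f x) * norm d" by (rule norm_cauchy_schwarz)
      also have "\<dots> \<le> (L * norm (t *\<^sub>R d)) * norm d"
        using lipschitz_onD[of L UNIV "gradient f" "x + t *\<^sub>R d" x] assms
        by (intro mult_right_mono) (auto simp: smooth_fun_def dist_norm)
      finally show ?thesis using that by (simp add: power2_eq_square)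
    qed
    ultimately show ?thesis by (intro exI conjI) (assumption, linarith)
  qed
  then have "\<psi> 1 \<le> \<psi> 0"
    by (intro DERIV_nonpos_imp_nonincreasing[of 0 1]) simp_all
  then show ?thesis by (simp add: \<psi>_def d_def)
qed

section \<open>Strong convexity and quadratic lower bounds\<close>

lemma norm_convex_combination:
  fixes x y :: "'a::real_inner"
  shows "(norm ((1 - t) *\<^sub>R x + t *\<^sub>R y))\<^sup>2
    = (1 - t) * (norm x)\<^sup>2 + t * (norm y)\<^sup>2 - t * (1 - t) * (norm (x - y))\<^sup>2"
  unfolding power2_norm_eq_inner by (simp add: inner_simps inner_commute algebra_simps)

lemma strongly_convexD:
  assumes "strongly_convex \<mu> f" "0 \<le> t" "t \<le> 1"
  shows "f ((1 - t) *\<^sub>R x + t *\<^sub>R y)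
    \<le> (1 - t) * f x + t * f y - \<mu> / 2 * t * (1 - t) * (norm (x - y))\<^sup>2"
proof -
  have "convex_on UNIV (\<lambda>x. f x - \<mu> / 2 * (norm x)\<^sup>2)"
    using assms(1) by (simp add: strongly_convex_def)
  from convex_onD[OF this assms(2,3), of x y]
  have "f ((1 - t) *\<^sub>R x + t *\<^sub>R y)
      \<le> (1 - t) * (f x - \<mu> / 2 * (norm x)\<^sup>2) + t * (f y - \<mu> / 2 * (norm y)\<^sup>2)
        + \<mu> / 2 * ((1 - t) * (norm x)\<^sup>2 + t * (norm y)\<^sup>2 - t * (1 - t) * (norm (x - y))\<^sup>2)"
    unfolding norm_convex_combination by simp
  also have "\<dots> = (1 - t) * f x + t * f y - \<mu> / 2 * t * (1 - t) * (norm (x - y))\<^sup>2"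
    by (simp add: algebra_simps add_divide_distrib diff_divide_distrib)
  finally show ?thesis .
qed

text \<open>Along the line through \<open>x\<close> and \<open>y\<close>, subtracting the quadratic
  term leaves a convex function \<phi> of one real variable. The subtracted term has zero derivative
  at \<open>0\<close>, so the slope of \<phi> there is that of \<open>f\<close>, and the tangent
  inequality is read off at \<open>1\<close>.\<close>

lemma strongly_convex_above_tangent:
  fixes f :: "'a::euclidean_space \<Rightarrow> real"
  assumes "strongly_convex \<mu> f" "f differentiable (at x)"
  shows "f x + inner (gradient f x) (y - x) + \<mu> / 2 * (norm (y - x))\<^sup>2 \<le> f y"
proof -
  define d where "d = y - x"
  define \<phi> where "\<phi> t = f (x + t *\<^sub>R d) - \<mu> / 2 * t\<^sup>2 * (norm d)\<^sup>2" for t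
  have "GDERIV f (x + 0 *\<^sub>R d) :> gradient f x"
    using assms by (simp add: gderiv_gradient)
  note [derivative_intros] = gderiv_along_line[OF this]
  have "(\<phi> has_real_derivative inner d (gradient f x)) (at 0)"
    unfolding \<phi>_def by (auto intro!: derivative_eq_intros)
  moreover have "convex_on UNIV \<phi>"
  proof (rule convex_onI)
    fix t a b :: real
    assume t: "0 < t" "t < 1"
    have eq: "(1 - t) *\<^sub>R (x + a *\<^sub>R d) + t *\<^sub>R (x + b *\<^sub>R d)
        = x + ((1 - t) *\<^sub>R a + t *\<^sub>R b) *\<^sub>R d"
      by (simp add: algebra_simps)
    have "x + a *\<^sub>R d - (x + b *\<^sub>R d) = (a - b) *\<^sub>R d"
      by (simp add: algebra_simps)
    then have norm_eq: "(norm (x + a *\<^sub>R d - (x + b *\<^sub>R d)))\<^sup>2 = (a - b)\<^sup>2 * (norm d)\<^sup>2"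
      by (simp add: power_mult_distrib)
    have "f (x + ((1 - t) *\<^sub>R a + t *\<^sub>R b) *\<^sub>R d)
        \<le> (1 - t) * f (x + a *\<^sub>R d) + t * f (x + b *\<^sub>R d)
          - \<mu> / 2 * t * (1 - t) * ((a - b)\<^sup>2 * (norm d)\<^sup>2)"
      using strongly_convexD[OF assms(1), of t "x + a *\<^sub>R d" "x + b *\<^sub>R d"] t
      unfolding eq norm_eq by simp
    \<comment> \<open>The convexity defect of the subtracted quadratic equals the gain from strong
      convexity, so the two cancel in \<phi>.\<close>
    moreover have "\<mu> / 2 * ((1 - t) *\<^sub>R a + t *\<^sub>R b)\<^sup>2 * (norm d)\<^sup>2
        = (1 - t) * (\<mu> / 2 * a\<^sup>2 * (norm d)\<^sup>2) + t * (\<mu> / 2 * b\<^sup>2 * (norm d)\<^sup>2)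
          - \<mu> / 2 * t * (1 - t) * ((a - b)\<^sup>2 * (norm d)\<^sup>2)"
      by (simp add: power2_eq_square algebra_simps add_divide_distrib diff_divide_distrib)
    ultimately show "\<phi> ((1 - t) *\<^sub>R a + t *\<^sub>R b) \<le> (1 - t) * \<phi> a + t * \<phi> b"
      unfolding \<phi>_def by (simp only: right_diff_distrib)
  qed simp
  ultimately have "\<phi> 1 - \<phi> 0 \<ge> inner d (gradient f x) * (1 - 0)"
    by (intro convex_on_imp_above_tangent[where A = UNIV]) simp_all
  then show ?thesis by (simp add: \<phi>_def d_def inner_commute)
qed

text \<open>The quadratic lower and upper bounds at \<open>0\<close> are compared at a unit vector.
  The purpose is \<open>0 < L\<close>, since \<open>smooth_fun\<close> by itself only gives
  \<open>0 \<le> L\<close> while the stepsize is \<open>1 / L\<close>.\<close>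

lemma strongly_convex_smooth_le:
  fixes f :: "'a::euclidean_space \<Rightarrow> real"
  assumes "strongly_convex \<mu> f" "smooth_fun L f"
  shows "\<mu> \<le> L"
proof -
  obtain b :: 'a where b: "b \<in> Basis" using nonempty_Basis by blast
  have "f differentiable (at 0)" using assms by (simp add: smooth_fun_def)
  from strongly_convex_above_tangent[OF assms(1) this, of b] descent_lemma[OF assms(2), of b 0]
  show ?thesis using b by simp
qed

section \<open>Proximal operator and proximal gradient step\<close>

text \<open>\<open>prox\<close> is a choice term, so a minimiser must be shown to exist. A convex
  function falls at most linearly away from \<open>x\<close>, so the quadratic term dominates
  outside a large ball, and inside it compactness applies.\<close>

lemma prox_is_arg_min:
  fixes g :: "'a::euclidean_space \<Rightarrow> real"
  assumes g: "convex_on UNIV g" and \<beta>: "0 \<le> \<beta>"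
  shows "\<beta> * g (prox \<beta> g x) + 1 / 2 * (norm (prox \<beta> g x - x))\<^sup>2
    \<le> \<beta> * g u + 1 / 2 * (norm (u - x))\<^sup>2"
proof -
  define h where "h u = \<beta> * g u + 1 / 2 * (norm (u - x))\<^sup>2" for u
  have cont: "continuous_on S g" for S
    using convex_on_continuous[OF open_UNIV g] continuous_on_subset by blast
  obtain w0 where w0: "\<And>w. w \<in> cball x 1 \<Longrightarrow> g w0 \<le> g w"
    using continuous_attains_inf[OF compact_cball _ cont, of x 1] by force
  define M where "M = g x - g w0"
  have M: "0 \<le> M" using w0[of x] by (simp add: M_def)
  have lower: "g x - norm (u - x) * M \<le> g u" if r: "1 \<le> norm (u - x)" for u
  proof -
    \<comment> \<open>The factor \<open>s\<close> pulls \<open>u\<close> back to the unit sphere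
      around \<open>x\<close>, where \<open>g\<close> is at least \<open>g w0\<close>; convexity on
      the segment extends this bound linearly out to \<open>u\<close>.\<close>
    define s where "s = 1 / norm (u - x)"
    have s: "0 \<le> s" "s \<le> 1" using r by (simp_all add: s_def divide_le_eq)
    have eq: "(1 - s) *\<^sub>R x + s *\<^sub>R u = x + s *\<^sub>R (u - x)"
      by (simp add: algebra_simps)
    have "g w0 \<le> g (x + s *\<^sub>R (u - x))"
      using r by (intro w0) (auto simp: dist_norm s_def)
    also have "\<dots> \<le> (1 - s) * g x + s * g u"
      using convex_onD[OF g s, of x u] unfolding eq by simp
    finally have "s * (g x - g u) \<le> M" by (simp add: M_def algebra_simps)
    then have "norm (u - x) * (s * (g x - g u)) \<le> norm (u - x) * M"
      by (rule mult_left_mono) simp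
    moreover have "norm (u - x) * s = 1" using r by (auto simp: s_def)
    ultimately show ?thesis by (simp flip: mult.assoc)
  qed
  \<comment> \<open>Beyond radius \<open>1\<close> the bound \<open>lower\<close> applies; beyond
    \<open>2 * \<beta> * M\<close> half the squared distance outweighs the possible loss
    \<open>\<beta> * M * r\<close>, so \<open>x\<close> already beats every point outside.\<close>
  define R where "R = max 1 (2 * \<beta> * M)"
  have "continuous_on (cball x R) h"
    unfolding h_def by (intro continuous_intros cont)
  then obtain p where p: "\<And>u. u \<in> cball x R \<Longrightarrow> h p \<le> h u"
    using continuous_attains_inf[OF compact_cball, of x R h] by (force simp: R_def)
  have "h p \<le> h u" for u
  proof (cases "u \<in> cball x R")
    case False
    define r where "r = norm (u - x)"
    have r: "1 \<le> r" "2 * \<beta> * M \<le> r"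
      using False by (auto simp: R_def r_def dist_norm norm_minus_commute)
    have "h p \<le> h x" by (rule p) (simp add: R_def)
    also have "\<dots> \<le> \<beta> * (g x - r * M) + 1 / 2 * r\<^sup>2"
      using mult_left_mono[OF r(2), of r] r(1)
      by (simp add: h_def power2_eq_square algebra_simps)
    also have "\<dots> \<le> h u"
      using mult_left_mono[OF lower \<beta>, of u] r(1) by (simp add: h_def r_def)
    finally show ?thesis .
  qed (rule p)
  then have "is_arg_min h (\<lambda>_. True) p" by (simp add: is_arg_min_linorder)
  then have "is_arg_min h (\<lambda>_. True) (arg_min h (\<lambda>_. True))"
    unfolding arg_min_def by (rule someI)
  moreover have "arg_min h (\<lambda>_. True) = prox \<beta> g x"
    by (simp add: prox_def h_def[abs_def])
  ultimately show ?thesis by (simp add: is_arg_min_linorder h_def)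
qed

text \<open>The new point minimises the linearisation of \<open>f\<close> plus \<open>g\<close> plus
  the quadratic term. By the descent lemma this model lies above \<open>F\<close> at the new point;
  by the tangent inequality its value at \<open>u\<close> is at most the right-hand side.\<close>

lemma prox_gradient_step:
  fixes f g :: "'a::euclidean_space \<Rightarrow> real"
  assumes f: "smooth_fun L f" "strongly_convex \<mu> f" and g: "convex_on UNIV g"
  defines "F \<equiv> \<lambda>x. f x + g x"
  shows "F (prox (1 / L) g (x - (1 / L) *\<^sub>R gradient f x)) \<le> F u + L / 2 * (norm (u - x))\<^sup>2"
proof -
  define D where "D = gradient f x"
  define p where "p = prox (1 / L) g (x - (1 / L) *\<^sub>R D)"
  have \<mu>: "0 < \<mu>" using f by (simp add: strongly_convex_def)
  have L: "0 < L" using strongly_convex_smooth_le[OF f(2,1)] \<mu> by simp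
  \<comment> \<open>Completing the square: \<open>L\<close> times the prox objective is the model up
    to a constant independent of \<open>v\<close>, which cancels when \<open>p\<close> and
    \<open>u\<close> are compared.\<close>
  have expand: "L * (1 / L * g v + 1 / 2 * (norm (v - (x - (1 / L) *\<^sub>R D)))\<^sup>2)
      = g v + inner D (v - x) + L / 2 * (norm (v - x))\<^sup>2 + (norm D)\<^sup>2 / (2 * L)" for v
  proof -
    have "v - (x - (1 / L) *\<^sub>R D) = (v - x) + (1 / L) *\<^sub>R D" by simp
    then have "(norm (v - (x - (1 / L) *\<^sub>R D)))\<^sup>2
        = (norm (v - x))\<^sup>2 + 2 / L * inner D (v - x) + (norm D)\<^sup>2 / L\<^sup>2"
      using L by (simp only: power2_norm_eq_inner)
        (simp add: inner_add_left inner_add_right inner_commute power2_eq_square)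
    then show ?thesis using L by (simp add: field_simps power2_eq_square)
  qed
  have "1 / L * g p + 1 / 2 * (norm (p - (x - (1 / L) *\<^sub>R D)))\<^sup>2
      \<le> 1 / L * g u + 1 / 2 * (norm (u - (x - (1 / L) *\<^sub>R D)))\<^sup>2"
    unfolding p_def using L by (intro prox_is_arg_min g) simp
  then have "g p + inner D (p - x) + L / 2 * (norm (p - x))\<^sup>2
      \<le> g u + inner D (u - x) + L / 2 * (norm (u - x))\<^sup>2"
    using mult_left_mono[of _ _ L] L expand by (smt (verit))
  moreover have "f p \<le> f x + inner D (p - x) + L / 2 * (norm (p - x))\<^sup>2"
    unfolding D_def by (rule descent_lemma[OF f(1)])
  moreover have "f x + inner D (u - x) \<le> f u"
  proof -
    have "f differentiable (at x)" using f by (simp add: smooth_fun_def)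
    moreover have "0 \<le> \<mu> / 2 * (norm (u - x))\<^sup>2" using \<mu> by simp
    ultimately show ?thesis
      using strongly_convex_above_tangent[OF f(2), of x u] unfolding D_def by linarith
  qed
  ultimately have "F p \<le> F u + L / 2 * (norm (u - x))\<^sup>2" unfolding F_def by linarith
  then show ?thesis by (simp add: p_def D_def)
qed

section \<open>Boundedness of sublevel sets\<close>

lemma strongly_convex_add_convex:
  assumes "strongly_convex \<mu> f" "convex_on UNIV g"
  shows "strongly_convex \<mu> (\<lambda>x. f x + g x)"
proof -
  have "convex_on UNIV (\<lambda>x. (f x - \<mu> / 2 * (norm x)\<^sup>2) + g x)"
    using assms by (intro convex_on_add) (auto simp: strongly_convex_def)
  moreover have "(\<lambda>x. (f x - \<mu> / 2 * (norm x)\<^sup>2) + g x) = (\<lambda>x. f x + g x - \<mu> / 2 * (norm x)\<^sup>2)"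
    by auto
  ultimately show ?thesis using assms by (simp add: strongly_convex_def)
qed

text \<open>Strong convexity at the midpoint of \<open>p\<close> and \<open>x\<close>, whose value
  is at least \<open>F p\<close>, bounds the distance. Boundedness is what makes
  \<open>diameter\<close>, a supremum of reals, an actual bound on distances.\<close>

lemma strongly_convex_bounded_sublevel:
  assumes F: "strongly_convex \<mu> F" and p: "\<And>x. F p \<le> F x"
  shows "bounded {x. F x \<le> a}"
proof -
  have \<mu>: "0 < \<mu>" using F by (simp add: strongly_convex_def)
  have "dist p x \<le> sqrt (4 * (a - F p) / \<mu>)" if "F x \<le> a" for x
  proof -
    have "F p \<le> F ((1 - 1 / 2) *\<^sub>R p + (1 / 2) *\<^sub>R x)" by (rule p)
    also have "\<dots> \<le> (1 - 1 / 2) * F p + 1 / 2 * F x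
        - \<mu> / 2 * (1 / 2) * (1 - 1 / 2) * (norm (p - x))\<^sup>2"
      by (rule strongly_convexD[OF F]) auto
    finally have "\<mu> * (norm (p - x))\<^sup>2 \<le> 4 * (F x - F p)" by simp
    also have "\<dots> \<le> 4 * (a - F p)" using that by simp
    finally have "(norm (p - x))\<^sup>2 \<le> 4 * (a - F p) / \<mu>"
      using \<mu> by (simp add: field_simps)
    then show ?thesis by (simp add: dist_norm real_le_rsqrt)
  qed
  then show ?thesis by (auto simp: bounded_def)
qed

section \<open>Line search and the 1/k rate\<close>

lemma backtracking_nonincreasing:
  "backtracking F y d \<epsilon> \<alpha> z \<Longrightarrow> F z \<le> F y"
  by (induction rule: backtracking.induct) auto

lemma sublinear_rate:
  fixes e :: "nat \<Rightarrow> real"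
  assumes step: "\<And>k t. k \<ge> 1 \<Longrightarrow> 0 \<le> t \<Longrightarrow> t \<le> 1 \<Longrightarrow> e (k + 1) \<le> (1 - t) * e k + t\<^sup>2 * B / 2"
    and C: "8 * B \<le> C" "e 1 \<le> C" "0 \<le> C" and k: "k \<ge> 1"
  shows "e (k + 1) \<le> C / real k"
  using k
proof (induction k rule: nat_induct_at_least)
  case base
  \<comment> \<open>Taking \<open>t = 0\<close> gives \<open>e 2 \<le> e 1\<close>.\<close>
  show ?case using step[of 1 0] C by simp
next
  case (Suc k)
  \<comment> \<open>The recursion is used at index \<open>Suc k\<close>, where the induction
    hypothesis reads \<open>e (k + 1) \<le> C / k\<close>. Then \<open>(1 - t) / k\<close> falls
    short of \<open>1 / (k + 1)\<close> by \<open>1 / (k * (k + 1))\<close>, which absorbs the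
    quadratic term.\<close>
  define t where "t = 2 / (real k + 1)"
  have k: "1 \<le> real k" using Suc.hyps by simp
  then have t: "0 \<le> t" "t \<le> 1" by (auto simp: t_def)
  have "e (Suc k + 1) \<le> (1 - t) * e (k + 1) + t\<^sup>2 * B / 2"
    using step[of "Suc k" t] t by simp
  also have "\<dots> \<le> (1 - t) * (C / k) + t\<^sup>2 * (C / 8) / 2"
    using Suc.IH C t by (intro add_mono mult_left_mono divide_right_mono) auto
  also have "\<dots> = C * ((1 - t) / k + t\<^sup>2 / 16)" by (simp add: algebra_simps)
  also have "\<dots> \<le> C * (1 / (real k + 1))"
  proof (rule mult_left_mono[OF _ C(3)])
    have "1 / (real k + 1) - ((1 - t) / k + t\<^sup>2 / 16) = 1 / (k * (real k + 1)) - 1 / (4 * (real k + 1)\<^sup>2)"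
      using k by (simp add: t_def divide_simps) (simp add: algebra_simps power2_eq_square)
    also have "\<dots> \<ge> 0"
    proof -
      have "k * (real k + 1) \<le> 4 * (real k + 1)\<^sup>2"
        using k by (simp add: power2_eq_square algebra_simps)
      then show ?thesis using k by (simp add: frac_le)
    qed
    finally show "(1 - t) / k + t\<^sup>2 / 16 \<le> 1 / (real k + 1)" by simp
  qed
  finally show ?case by (simp add: add.commute)
qed

section \<open>The two-level iteration\<close>

theorem theorem2p13:
  fixes f0 g0 F0 :: "real^'n \<Rightarrow> real"
    and g :: "'n \<Rightarrow> real \<Rightarrow> real"
    and f1 g1 F1 :: "real^'m \<Rightarrow> real"
    and Q :: "real^'m^'n"
    and Rbar :: "real^'n^'m"
    and L0 \<mu>0 c \<epsilon> \<delta> :: real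
    and x0 y0 z0 :: "nat \<Rightarrow> real^'n"
    and x1 y1 \<tau> :: "nat \<Rightarrow> real^'m"
    and \<alpha> :: "nat \<Rightarrow> real"
    and xstar :: "real^'n"
  assumes f0_smooth: "smooth_fun L0 f0"
    and f0_strongly_convex: "strongly_convex \<mu>0 f0"
    and g0_convex: "convex_on UNIV g0"
    and g0_separable: "\<forall>x. g0 x = (\<Sum>i\<in>UNIV. g i (x $ i))"
    and g_nondiff: "\<forall>i. \<exists>\<^sub>\<le>\<^sub>1 t. \<not> g i differentiable (at t)"
    and F0_eq: "F0 = (\<lambda>x. f0 x + g0 x)"
    and dims: "CARD('m) \<le> CARD('n)"
    and Q_rank: "rank Q = CARD('m)"
    and f1_eq: "f1 = (\<lambda>\<xi>. f0 (Q *v \<xi>))"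
    and g1_eq: "g1 = (\<lambda>\<xi>. g0 (Q *v \<xi>))"
    and F1_eq: "F1 = (\<lambda>\<xi>. f1 \<xi> + g1 \<xi>)"
    and c_pos: "c > 0"
    and eps_pos: "\<epsilon> > 0"
    and step_i: "\<forall>k\<ge>1. y0 (k + 1) = prox (1 / L0) g0 (x0 k - (1 / L0) *\<^sub>R gradient f0 (x0 k))"
    and step_ii: "\<forall>k\<ge>1. y1 (k + 1) = adaptive_restriction g Rbar (y0 (k + 1)) *v y0 (k + 1)"
    and step_iii: "\<forall>k\<ge>1. \<tau> (k + 1) \<in>
        {s - adaptive_restriction g Rbar (y0 (k + 1)) *v t | s t.
           s \<in> subdifferential F1 (y1 (k + 1)) \<and> t \<in> subdifferential F0 (y0 (k + 1))}"
    and step_iv: "\<forall>k\<ge>1. is_arg_min (\<lambda>\<xi>. F1 \<xi> - inner (\<tau> (k + 1)) \<xi>) (\<lambda>_. True) (x1 (k + 1))"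
    and alpha_pos: "\<forall>k\<ge>1. \<alpha> (k + 1) > 0"
    and step_v: "\<forall>k\<ge>1. backtracking F0 (y0 (k + 1))
        (prolongation c g Rbar (y0 (k + 1)) *v (x1 (k + 1) - y1 (k + 1)))
        \<epsilon> (\<alpha> (k + 1)) (z0 (k + 1))"
    and step_vi: "\<forall>k\<ge>1. x0 (k + 1) =
        prox (1 / L0) g0 (z0 (k + 1) - (1 / L0) *\<^sub>R gradient f0 (z0 (k + 1)))"
    and xstar: "is_arg_min F0 (\<lambda>_. True) xstar"
    and delta: "\<delta> = diameter {x. F0 x \<le> F0 (x0 1)}"
  shows "\<forall>k\<ge>1. F0 (x0 (k + 1)) - F0 xstar
           \<le> max (8 * \<delta>\<^sup>2 * L0) (F0 (x0 1) - F0 xstar) / real k"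
proof -
  have F: "strongly_convex \<mu>0 F0"
    unfolding F0_eq by (rule strongly_convex_add_convex[OF f0_strongly_convex g0_convex])
  then have \<mu>: "0 < \<mu>0" by (simp add: strongly_convex_def)
  have L: "0 < L0" using strongly_convex_smooth_le[OF f0_strongly_convex f0_smooth] \<mu> by simp
  have opt: "F0 xstar \<le> F0 x" for x using xstar by (simp add: is_arg_min_linorder)
  have prox_step: "F0 (prox (1 / L0) g0 (x - (1 / L0) *\<^sub>R gradient f0 x))
      \<le> F0 u + L0 / 2 * (norm (u - x))\<^sup>2" for x u
    unfolding F0_eq by (rule prox_gradient_step[OF f0_smooth f0_strongly_convex g0_convex])
  \<comment> \<open>The coarse correction enters through the backtracking guarantee; the second
    proximal step, tested against its own starting point, does not increase \<open>F0\<close>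
    either.\<close>
  have le_y: "F0 (x0 (k + 1)) \<le> F0 (y0 (k + 1))" if "k \<ge> 1" for k
  proof -
    have "F0 (x0 (k + 1)) \<le> F0 (z0 (k + 1))"
      using prox_step[of "z0 (k + 1)" "z0 (k + 1)"] step_vi that by simp
    also have "\<dots> \<le> F0 (y0 (k + 1))"
      using step_v that by (blast intro: backtracking_nonincreasing)
    finally show ?thesis .
  qed
  \<comment> \<open>The estimate for the first proximal step thus carries over to the whole
    iteration.\<close>
  have step: "F0 (x0 (k + 1)) \<le> F0 u + L0 / 2 * (norm (u - x0 k))\<^sup>2" if "k \<ge> 1" for k u
    using le_y[OF that] prox_step[of "x0 k" u] step_i that by simp
  have sublevel: "F0 (x0 k) \<le> F0 (x0 1)" if "k \<ge> 1" for k
    using that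
  proof (induction k rule: nat_induct_at_least)
    case (Suc k)
    then show ?case using step[of k "x0 k"] by simp
  qed simp
  have dist: "norm (x0 k - xstar) \<le> \<delta>" if "k \<ge> 1" for k
    unfolding delta dist_norm[symmetric]
    using sublevel[OF that] opt strongly_convex_bounded_sublevel[OF F opt]
    by (intro diameter_bounded_bound) auto
  define e where "e k = F0 (x0 k) - F0 xstar" for k
  have rec: "e (k + 1) \<le> (1 - t) * e k + t\<^sup>2 * (\<delta>\<^sup>2 * L0) / 2"
    if k: "k \<ge> 1" and t: "0 \<le> t" "t \<le> 1" for k t
  proof -
    \<comment> \<open>The comparison point lies a fraction \<open>t\<close> of the way to the
      minimiser, hence within \<open>t * \<delta>\<close> of \<open>x0 k\<close>.\<close>
    define u where "u = (1 - t) *\<^sub>R x0 k + t *\<^sub>R xstar"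
    have "u - x0 k = - (t *\<^sub>R (x0 k - xstar))" by (simp add: u_def algebra_simps)
    then have norm_u: "norm (u - x0 k) = t * norm (x0 k - xstar)" using t by simp
    have "(norm (u - x0 k))\<^sup>2 \<le> (t * \<delta>)\<^sup>2"
      unfolding norm_u using dist[OF k] t by (intro power_mono mult_left_mono) auto
    then have "L0 / 2 * (norm (u - x0 k))\<^sup>2 \<le> L0 / 2 * (t * \<delta>)\<^sup>2"
      using L by (intro mult_left_mono) auto
    moreover have "F0 u \<le> (1 - t) * F0 (x0 k) + t * F0 xstar"
    proof -
      have "0 \<le> \<mu>0 / 2 * t * (1 - t) * (norm (x0 k - xstar))\<^sup>2" using \<mu> t by simp
      then show ?thesis
        using strongly_convexD[OF F t, of "x0 k" xstar] unfolding u_def by linarith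
    qed
    ultimately show ?thesis
      using step[OF k, of u] by (simp add: e_def power_mult_distrib algebra_simps)
  qed
  \<comment> \<open>With \<open>B\<close> equal to \<open>\<delta>\<^sup>2 * L0\<close>, the two
    arguments of the maximum supply \<open>8 * B \<le> C\<close> and \<open>e 1 \<le> C\<close>;
    optimality of \<open>xstar\<close> gives \<open>0 \<le> C\<close>.\<close>
  have "e (k + 1) \<le> max (8 * \<delta>\<^sup>2 * L0) (F0 (x0 1) - F0 xstar) / real k" if "k \<ge> 1" for k
    using opt[of "x0 1"] that
    by (intro sublinear_rate[of e "\<delta>\<^sup>2 * L0"] rec) (auto simp: e_def)
  then show ?thesis by (simp add: e_def)
qed

end
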